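(* Let $X$ and $Y$ be real Banach spaces. Then the norm of the injective tensor product $X\hat{\otimes}_{\varepsilon}Y$ is non-rough if and only if the norms of both $X$ and $Y$ are non-rough.
   Context: All Banach spaces are real. $X\hat{\otimes}_{\varepsilon}Y$ is the completion of the algebraic tensor product $X\otimes Y$ under the injective norm $\|\sum_{i=1}^n x_i\otimes y_i\|_{\varepsilon}=\sup\{|\sum_{i=1}^n x^*(x_i)y^*(y_i)| : x^*\in S_{X^*},\,y^*\in S_{Y^*}\}$. For a Banach space $Z$ and $u$ in its unit sphere $S_Z$, the roughness of $Z$ at $u$ is $$\eta(Z,u)=\limsup_{\|h\|\to 0}\frac{\|u+h\|+\|u-h\|-2}{\|h\|}.$$ For $\varepsilon>0$, the norm of $Z$ is $\varepsilon$-rough if $\eta(Z,u)\ge\varepsilon$ for every $u\in S_Z$. The norm of $Z$ is rough if it is $\varepsilon$-rough for some $\varepsilon>0$, and non-rough otherwise. *)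

theory Defs
  imports "HOL-Analysis.Analysis" "HOL-Library.Poly_Mapping"
begin

section \<open>The algebraic tensor product\<close>

text \<open>
  The tensor product of two real vector spaces is the free real vector space on the product
  of the two spaces, divided by the span of the bilinearity relations.
\<close>

definition free_scale :: "real \<Rightarrow> ('c \<Rightarrow>\<^sub>0 real) \<Rightarrow> ('c \<Rightarrow>\<^sub>0 real)" where
  "free_scale r f = Poly_Mapping.map ((*) r) f"

lemma lookup_free_scale [simp]:
  "Poly_Mapping.lookup (free_scale r f) p = r * Poly_Mapping.lookup f p"
  unfolding free_scale_def by transfer (auto simp: when_def)

interpretation free: vector_space free_scale
  by unfold_locales
    (auto intro!: poly_mapping_eqI simp: lookup_add algebra_simps)

definition free_gen :: "'a \<Rightarrow> 'b \<Rightarrow> ('a \<times> 'b \<Rightarrow>\<^sub>0 real)" where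
  "free_gen x y = Poly_Mapping.single (x, y) 1"

definition tensor_relations :: "('a::real_vector \<times> 'b::real_vector \<Rightarrow>\<^sub>0 real) set" where
  "tensor_relations =
      {free_gen (x + x') y - free_gen x y - free_gen x' y | x x' y. True}
    \<union> {free_gen x (y + y') - free_gen x y - free_gen x y' | x y y'. True}
    \<union> {free_gen (r *\<^sub>R x) y - free_scale r (free_gen x y) | r x y. True}
    \<union> {free_gen x (r *\<^sub>R y) - free_scale r (free_gen x y) | r x y. True}"

quotient_type (overloaded) ('a, 'b) tensor =
    "'a::real_vector \<times> 'b::real_vector \<Rightarrow>\<^sub>0 real" /
    "\<lambda>f g. f - g \<in> free.span tensor_relations"
proof (rule equivpI)
  let ?R = "\<lambda>f g. f - g \<in> free.span (tensor_relations :: ('a \<times> 'b \<Rightarrow>\<^sub>0 real) set)"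
  show "reflp ?R"
    by (auto intro!: reflpI free.span_zero)
  show "symp ?R"
    using free.span_neg by (fastforce intro!: sympI)
  show "transp ?R"
    using free.span_add by (fastforce intro!: transpI)
qed

instantiation tensor :: (real_vector, real_vector) real_vector
begin

lift_definition zero_tensor :: "('a, 'b) tensor" is 0 .

lift_definition plus_tensor ::
  "('a, 'b) tensor \<Rightarrow> ('a, 'b) tensor \<Rightarrow> ('a, 'b) tensor" is "(+)"
  using free.span_add by (metis add_diff_add)

lift_definition uminus_tensor :: "('a, 'b) tensor \<Rightarrow> ('a, 'b) tensor" is uminus
  using free.span_neg by (metis minus_diff_minus)

lift_definition minus_tensor ::
  "('a, 'b) tensor \<Rightarrow> ('a, 'b) tensor \<Rightarrow> ('a, 'b) tensor" is "(-)"
proof -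
  fix f f' g g' :: "'a \<times> 'b \<Rightarrow>\<^sub>0 real"
  assume "f - f' \<in> free.span tensor_relations" "g - g' \<in> free.span tensor_relations"
  then have "(f - f') - (g - g') \<in> free.span tensor_relations"
    by (rule free.span_diff)
  then show "f - g - (f' - g') \<in> free.span tensor_relations"
    by (simp add: algebra_simps)
qed

lift_definition scaleR_tensor :: "real \<Rightarrow> ('a, 'b) tensor \<Rightarrow> ('a, 'b) tensor" is free_scale
  using free.span_scale by (metis free.scale_right_diff_distrib)

instance
  by standard (transfer; simp add: free.span_zero algebra_simps free.scale_right_distrib
      free.scale_left_distrib)+

end

lift_definition tensor :: "'a::real_vector \<Rightarrow> 'b::real_vector \<Rightarrow> ('a, 'b) tensor" is free_gen .

lemma tensor_add_left: "tensor (x + x') y = tensor x y + tensor x' y"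
proof transfer
  fix x x' :: 'a and y :: 'b
  have "free_gen (x + x') y - free_gen x y - free_gen x' y \<in> tensor_relations"
    unfolding tensor_relations_def by (intro UnI1) blast
  then show "free_gen (x + x') y - (free_gen x y + free_gen x' y) \<in> free.span tensor_relations"
    by (simp add: diff_diff_eq free.span_base)
qed

lemma tensor_add_right: "tensor x (y + y') = tensor x y + tensor x y'"
proof transfer
  fix x :: 'a and y y' :: 'b
  have "free_gen x (y + y') - free_gen x y - free_gen x y' \<in> tensor_relations"
    unfolding tensor_relations_def by (rule UnI1, rule UnI1, rule UnI2) blast
  then show "free_gen x (y + y') - (free_gen x y + free_gen x y') \<in> free.span tensor_relations"
    by (simp add: diff_diff_eq free.span_base)
qed

lemma tensor_scaleR_left: "tensor (r *\<^sub>R x) y = r *\<^sub>R tensor x y"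
proof transfer
  fix r and x :: 'a and y :: 'b
  have "free_gen (r *\<^sub>R x) y - free_scale r (free_gen x y) \<in> tensor_relations"
    unfolding tensor_relations_def by (rule UnI1, rule UnI2) blast
  then show "free_gen (r *\<^sub>R x) y - free_scale r (free_gen x y) \<in> free.span tensor_relations"
    by (rule free.span_base)
qed

lemma tensor_scaleR_right: "tensor x (r *\<^sub>R y) = r *\<^sub>R tensor x y"
proof transfer
  fix r and x :: 'a and y :: 'b
  have "free_gen x (r *\<^sub>R y) - free_scale r (free_gen x y) \<in> tensor_relations"
    unfolding tensor_relations_def by (rule UnI2) blast
  then show "free_gen x (r *\<^sub>R y) - free_scale r (free_gen x y) \<in> free.span tensor_relations"
    by (rule free.span_base)
qed

section \<open>The injective norm\<close>

definition free_eval ::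
    "('a::real_normed_vector \<Rightarrow>\<^sub>L real) \<Rightarrow> ('b::real_normed_vector \<Rightarrow>\<^sub>L real)
      \<Rightarrow> ('a \<times> 'b \<Rightarrow>\<^sub>0 real) \<Rightarrow> real" where
  "free_eval \<phi> \<psi> f =
    (\<Sum>(x, y)\<in>Poly_Mapping.keys f. Poly_Mapping.lookup f (x, y) * (\<phi> x * \<psi> y))"

lemma free_eval_superset:
  assumes "finite K" "Poly_Mapping.keys f \<subseteq> K"
  shows "free_eval \<phi> \<psi> f = (\<Sum>(x, y)\<in>K. Poly_Mapping.lookup f (x, y) * (\<phi> x * \<psi> y))"
  unfolding free_eval_def using assms
  by (intro sum.mono_neutral_left) (auto simp: in_keys_iff)

lemma free_eval_add: "free_eval \<phi> \<psi> (f + g) = free_eval \<phi> \<psi> f + free_eval \<phi> \<psi> g"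
proof -
  let ?K = "Poly_Mapping.keys f \<union> Poly_Mapping.keys g"
  have "Poly_Mapping.keys (f + g) \<subseteq> ?K"
    by (rule Poly_Mapping.keys_add)
  then show ?thesis
    by (subst (1 2 3) free_eval_superset[where K = ?K])
      (auto simp: lookup_add sum.distrib[symmetric] algebra_simps intro!: sum.cong)
qed

lemma free_eval_scale: "free_eval \<phi> \<psi> (free_scale r f) = r * free_eval \<phi> \<psi> f"
proof -
  have "Poly_Mapping.keys (free_scale r f) \<subseteq> Poly_Mapping.keys f"
    by (auto simp: in_keys_iff)
  then show ?thesis
    by (subst (1 2) free_eval_superset[where K = "Poly_Mapping.keys f"])
      (auto simp: sum_distrib_left algebra_simps intro!: sum.cong)
qed

lemma free_eval_diff: "free_eval \<phi> \<psi> (f - g) = free_eval \<phi> \<psi> f - free_eval \<phi> \<psi> g"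
proof -
  have "free_eval \<phi> \<psi> (f - g) + free_eval \<phi> \<psi> g = free_eval \<phi> \<psi> f"
    by (simp flip: free_eval_add)
  then show ?thesis by simp
qed

lemma free_eval_gen: "free_eval \<phi> \<psi> (free_gen x y) = \<phi> x * \<psi> y"
  by (simp add: free_eval_def free_gen_def)

lemma free_eval_relations:
  assumes "f \<in> free.span tensor_relations"
  shows "free_eval \<phi> \<psi> f = 0"
  using assms
proof (induction rule: free.span_induct_alt)
  case base
  show ?case by (simp add: free_eval_def)
next
  case (step r f g)
  have "free_eval \<phi> \<psi> f = 0"
    using step(1) unfolding tensor_relations_def
    by (safe; simp only: free_eval_diff free_eval_gen free_eval_scale blinfun.add_right
        blinfun.scaleR_right real_scaleR_def) (simp_all add: distrib_left distrib_right)
  with step show ?case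
    by (simp add: free_eval_add free_eval_scale)
qed

lift_definition tensor_eval ::
    "('a::real_normed_vector \<Rightarrow>\<^sub>L real) \<Rightarrow> ('b::real_normed_vector \<Rightarrow>\<^sub>L real)
      \<Rightarrow> ('a, 'b) tensor \<Rightarrow> real" is free_eval
  using free_eval_relations by (metis free_eval_diff right_minus_eq)

lemma tensor_eval_tensor [simp]: "tensor_eval \<phi> \<psi> (tensor x y) = \<phi> x * \<psi> y"
  by transfer (rule free_eval_gen)

lemma tensor_eval_add: "tensor_eval \<phi> \<psi> (u + v) = tensor_eval \<phi> \<psi> u + tensor_eval \<phi> \<psi> v"
  by transfer (rule free_eval_add)

lemma tensor_eval_scaleR: "tensor_eval \<phi> \<psi> (r *\<^sub>R u) = r * tensor_eval \<phi> \<psi> u"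
  by transfer (rule free_eval_scale)

lemma linear_tensor_eval: "linear (tensor_eval \<phi> \<psi>)"
  by (rule linearI) (simp_all add: tensor_eval_add tensor_eval_scaleR)

text \<open>
  The element 0 is inserted because the dual unit spheres are empty if one of the spaces is
  trivial; the tensor product is then trivial as well. It does not affect the supremum
  otherwise.
\<close>

definition inj_norm :: "('a::real_normed_vector, 'b::real_normed_vector) tensor \<Rightarrow> real" where
  "inj_norm u =
    Sup (insert 0 {\<bar>tensor_eval \<phi> \<psi> u\<bar> | \<phi> \<psi>. \<phi> \<in> sphere 0 1 \<and> \<psi> \<in> sphere 0 1})"

lemma inj_norm_sum_tensor:
  "inj_norm (\<Sum>i<n. tensor (x i) (y i)) =
    Sup (insert 0 {\<bar>\<Sum>i<n. blinfun_apply \<phi> (x i) * blinfun_apply \<psi> (y i)\<bar> | \<phi> \<psi>.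
      \<phi> \<in> sphere 0 1 \<and> \<psi> \<in> sphere 0 1})"
  for x :: "nat \<Rightarrow> 'a::real_normed_vector" and y :: "nat \<Rightarrow> 'b::real_normed_vector"
  unfolding inj_norm_def linear_sum[OF linear_tensor_eval] by simp

lemma tensor_eval_bounded:
  fixes u :: "('a::real_normed_vector, 'b::real_normed_vector) tensor"
  shows "\<exists>B. \<forall>\<phi> \<psi>. norm \<phi> = 1 \<longrightarrow> norm \<psi> = 1 \<longrightarrow> \<bar>tensor_eval \<phi> \<psi> u\<bar> \<le> B"
proof (transfer, intro exI allI impI)
  fix f :: "'a \<times> 'b \<Rightarrow>\<^sub>0 real" and \<phi> :: "'a \<Rightarrow>\<^sub>L real" and \<psi> :: "'b \<Rightarrow>\<^sub>L real"
  assume 1: "norm \<phi> = 1" "norm \<psi> = 1"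
  have "\<bar>\<phi> x * \<psi> y\<bar> \<le> norm x * norm y" for x y
    using norm_blinfun[of \<phi> x] norm_blinfun[of \<psi> y] 1
    by (simp add: abs_mult mult_mono)
  then show "\<bar>free_eval \<phi> \<psi> f\<bar> \<le>
      (\<Sum>(x, y)\<in>Poly_Mapping.keys f. \<bar>Poly_Mapping.lookup f (x, y)\<bar> * (norm x * norm y))"
    unfolding free_eval_def
    by (intro order.trans[OF sum_abs] sum_mono)
      (auto simp: abs_mult intro!: mult_left_mono)
qed

lemma tensor_eval_le_inj_norm:
  assumes "norm \<phi> = 1" "norm \<psi> = 1"
  shows "\<bar>tensor_eval \<phi> \<psi> u\<bar> \<le> inj_norm u"
proof -
  obtain B where "\<And>\<phi> \<psi>. norm \<phi> = 1 \<Longrightarrow> norm \<psi> = 1 \<Longrightarrow> \<bar>tensor_eval \<phi> \<psi> u\<bar> \<le> B"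
    using tensor_eval_bounded[of u] by blast
  then show ?thesis
    unfolding inj_norm_def using assms
    by (intro cSup_upper) (auto intro!: bdd_aboveI[where M = "max 0 B"] simp: le_max_iff_disj)
qed

lemma inj_norm_nonneg: "0 \<le> inj_norm u"
proof -
  obtain B where "\<And>\<phi> \<psi>. norm \<phi> = 1 \<Longrightarrow> norm \<psi> = 1 \<Longrightarrow> \<bar>tensor_eval \<phi> \<psi> u\<bar> \<le> B"
    using tensor_eval_bounded[of u] by blast
  then show ?thesis
    unfolding inj_norm_def
    by (intro cSup_upper) (auto intro!: bdd_aboveI[where M = "max 0 B"] simp: le_max_iff_disj)
qed

lemma inj_norm_le:
  assumes "0 \<le> B" "\<And>\<phi> \<psi>. norm \<phi> = 1 \<Longrightarrow> norm \<psi> = 1 \<Longrightarrow> \<bar>tensor_eval \<phi> \<psi> u\<bar> \<le> B"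
  shows "inj_norm u \<le> B"
  unfolding inj_norm_def using assms by (intro cSup_least) auto

lemma inj_norm_triangle: "inj_norm (u + v) \<le> inj_norm u + inj_norm v"
proof (rule inj_norm_le)
  show "\<bar>tensor_eval \<phi> \<psi> (u + v)\<bar> \<le> inj_norm u + inj_norm v"
    if "norm \<phi> = 1" "norm \<psi> = 1" for \<phi> \<psi>
    using tensor_eval_le_inj_norm[OF that, of u] tensor_eval_le_inj_norm[OF that, of v]
    by (simp add: tensor_eval_add)
qed (simp add: inj_norm_nonneg)

lemma inj_norm_scaleR: "inj_norm (r *\<^sub>R u) = \<bar>r\<bar> * inj_norm u"
proof -
  have le: "inj_norm (r *\<^sub>R u) \<le> \<bar>r\<bar> * inj_norm u"
    for r and u :: "('a::real_normed_vector, 'b::real_normed_vector) tensor"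
    by (rule inj_norm_le)
      (auto simp: inj_norm_nonneg tensor_eval_scaleR abs_mult
        intro!: mult_left_mono tensor_eval_le_inj_norm)
  show ?thesis
  proof (cases "r = 0")
    case True
    then show ?thesis using le[of 0 u] inj_norm_nonneg[of "0 *\<^sub>R u"] by simp
  next
    case False
    then have "\<bar>r\<bar> * inj_norm u \<le> inj_norm (r *\<^sub>R u)"
      using le[of "1 / r" "r *\<^sub>R u"] by (simp add: field_simps)
    with le[of r u] show ?thesis by simp
  qed
qed

lemma inj_norm_zero [simp]: "inj_norm 0 = 0"
  using inj_norm_scaleR[of 0 0] by simp

lemma inj_norm_minus [simp]: "inj_norm (- u) = inj_norm u"
  using inj_norm_scaleR[of "-1" u] by simp

lemma inj_norm_minus_commute: "inj_norm (u - v) = inj_norm (v - u)"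
  using inj_norm_minus[of "u - v"] by simp

lemma inj_norm_triangle_sub: "inj_norm (u - w) \<le> inj_norm (u - v) + inj_norm (v - w)"
  using inj_norm_triangle[of "u - v" "v - w"] by simp

lemma inj_norm_reverse_triangle: "\<bar>inj_norm u - inj_norm v\<bar> \<le> inj_norm (u - v)"
  using inj_norm_triangle[of "u - v" v] inj_norm_triangle[of "v - u" u]
  by (simp add: inj_norm_minus_commute[of v u])

section \<open>The completion\<close>

text \<open>
  Cauchy sequences for the injective norm modulo sequences whose norms tend to 0. That
  the injective norm is definite on the algebraic tensor product follows from the
  Hahn-Banach theorem; the construction needs only its seminorm properties, so definiteness
  is not proved here.
\<close>

definition inj_Cauchy ::
    "(nat \<Rightarrow> ('a::real_normed_vector, 'b::real_normed_vector) tensor) \<Rightarrow> bool" where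
  "inj_Cauchy U \<longleftrightarrow> (\<forall>e>0. \<exists>N. \<forall>m\<ge>N. \<forall>n\<ge>N. inj_norm (U m - U n) < e)"

definition inj_equiv ::
    "(nat \<Rightarrow> ('a::real_normed_vector, 'b::real_normed_vector) tensor) \<Rightarrow>
      (nat \<Rightarrow> ('a, 'b) tensor) \<Rightarrow> bool" where
  "inj_equiv U V \<longleftrightarrow>
    inj_Cauchy U \<and> inj_Cauchy V \<and> (\<lambda>n. inj_norm (U n - V n)) \<longlonglongrightarrow> 0"

lemma inj_null_mono:
  assumes "V \<longlonglongrightarrow> 0" "\<And>n. inj_norm (U n) \<le> V n"
  shows "(\<lambda>n. inj_norm (U n)) \<longlonglongrightarrow> 0"
  by (rule tendsto_sandwich[OF _ _ tendsto_const assms(1)])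
    (auto simp: assms inj_norm_nonneg)

lemma inj_Cauchy_const: "inj_Cauchy (\<lambda>_. u)"
  by (simp add: inj_Cauchy_def)

lemma inj_Cauchy_add:
  assumes "inj_Cauchy U" "inj_Cauchy V"
  shows "inj_Cauchy (\<lambda>n. U n + V n)"
  unfolding inj_Cauchy_def
proof (intro allI impI)
  fix e :: real assume "e > 0"
  then have "e / 2 > 0" by simp
  with assms obtain M N
    where "\<forall>m\<ge>M. \<forall>n\<ge>M. inj_norm (U m - U n) < e / 2"
      and "\<forall>m\<ge>N. \<forall>n\<ge>N. inj_norm (V m - V n) < e / 2"
    unfolding inj_Cauchy_def by meson
  then have "inj_norm (U m + V m - (U n + V n)) < e" if "m \<ge> max M N" "n \<ge> max M N" for m n
    using inj_norm_triangle[of "U m - U n" "V m - V n"] that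
    by (fastforce simp: add_diff_add)
  then show "\<exists>N. \<forall>m\<ge>N. \<forall>n\<ge>N. inj_norm (U m + V m - (U n + V n)) < e"
    by blast
qed

lemma inj_Cauchy_scaleR:
  assumes "inj_Cauchy U"
  shows "inj_Cauchy (\<lambda>n. r *\<^sub>R U n)"
  unfolding inj_Cauchy_def
proof (intro allI impI)
  fix e :: real assume e: "e > 0"
  then have "e / (\<bar>r\<bar> + 1) > 0" by simp
  with assms obtain N where N: "\<forall>m\<ge>N. \<forall>n\<ge>N. inj_norm (U m - U n) < e / (\<bar>r\<bar> + 1)"
    unfolding inj_Cauchy_def by meson
  have "inj_norm (r *\<^sub>R U m - r *\<^sub>R U n) < e" if "m \<ge> N" "n \<ge> N" for m n
  proof -
    have "inj_norm (r *\<^sub>R U m - r *\<^sub>R U n) \<le> (\<bar>r\<bar> + 1) * inj_norm (U m - U n)"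
      using inj_norm_nonneg[of "U m - U n"]
      by (simp add: inj_norm_scaleR algebra_simps flip: scaleR_diff_right)
    also have "\<dots> < e"
      using N that by (auto simp: field_simps)
    finally show ?thesis .
  qed
  then show "\<exists>N. \<forall>m\<ge>N. \<forall>n\<ge>N. inj_norm (r *\<^sub>R U m - r *\<^sub>R U n) < e"
    by blast
qed

lemma inj_Cauchy_minus: "inj_Cauchy U \<Longrightarrow> inj_Cauchy (\<lambda>n. - U n)"
  using inj_Cauchy_scaleR[of U "-1"] by simp

lemma inj_Cauchy_diff: "inj_Cauchy U \<Longrightarrow> inj_Cauchy V \<Longrightarrow> inj_Cauchy (\<lambda>n. U n - V n)"
  using inj_Cauchy_add[of U "\<lambda>n. - V n"] by (simp add: inj_Cauchy_minus)

lemma inj_equiv_refl: "inj_Cauchy U \<Longrightarrow> inj_equiv U U"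
  by (simp add: inj_equiv_def)

lemma inj_equiv_add:
  assumes "inj_equiv U U'" "inj_equiv V V'"
  shows "inj_equiv (\<lambda>n. U n + V n) (\<lambda>n. U' n + V' n)"
  using assms unfolding inj_equiv_def
  by (auto intro!: inj_Cauchy_add
      inj_null_mono[OF tendsto_add_zero, of "\<lambda>n. inj_norm (U n - U' n)" "\<lambda>n. inj_norm (V n - V' n)"]
      simp: add_diff_add inj_norm_triangle)

lemma inj_equiv_scaleR:
  assumes "inj_equiv U V"
  shows "inj_equiv (\<lambda>n. r *\<^sub>R U n) (\<lambda>n. r *\<^sub>R V n)"
  using assms tendsto_mult_left[of "\<lambda>n. inj_norm (U n - V n)" 0 sequentially "\<bar>r\<bar>"]
  unfolding inj_equiv_def
  by (auto intro!: inj_Cauchy_scaleR simp: inj_norm_scaleR simp flip: scaleR_diff_right)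

lemma inj_equiv_minus: "inj_equiv U V \<Longrightarrow> inj_equiv (\<lambda>n. - U n) (\<lambda>n. - V n)"
  using inj_equiv_scaleR[of U V "-1"] by simp

lemma inj_equiv_diff:
  "inj_equiv U U' \<Longrightarrow> inj_equiv V V' \<Longrightarrow> inj_equiv (\<lambda>n. U n - V n) (\<lambda>n. U' n - V' n)"
  using inj_equiv_add[of U U' "\<lambda>n. - V n" "\<lambda>n. - V' n"] by (simp add: inj_equiv_minus)

lemma inj_Cauchy_norm_convergent:
  assumes "inj_Cauchy U"
  shows "convergent (\<lambda>n. inj_norm (U n))"
proof -
  have "Cauchy (\<lambda>n. inj_norm (U n))"
    unfolding Cauchy_def dist_real_def
    using assms inj_norm_reverse_triangle unfolding inj_Cauchy_def
    by (meson order.strict_trans1)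
  then show ?thesis by (rule Cauchy_convergent)
qed

lemma inj_Cauchy_norm_lim:
  "inj_Cauchy U \<Longrightarrow> (\<lambda>n. inj_norm (U n)) \<longlonglongrightarrow> lim (\<lambda>n. inj_norm (U n))"
  using inj_Cauchy_norm_convergent convergent_LIMSEQ_iff by blast

lifting_forget tensor.lifting

quotient_type (overloaded) ('a, 'b) inj_tensor =
    "nat \<Rightarrow> ('a::real_normed_vector, 'b::real_normed_vector) tensor" / partial: inj_equiv
proof (rule part_equivpI)
  show "\<exists>U :: nat \<Rightarrow> ('a, 'b) tensor. inj_equiv U U"
    using inj_equiv_refl inj_Cauchy_const by blast
  show "symp (inj_equiv :: (nat \<Rightarrow> ('a, 'b) tensor) \<Rightarrow> _)"
    by (intro sympI) (simp add: inj_equiv_def inj_norm_minus_commute)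
  show "transp (inj_equiv :: (nat \<Rightarrow> ('a, 'b) tensor) \<Rightarrow> _)"
  proof (rule transpI)
    fix U V W :: "nat \<Rightarrow> ('a, 'b) tensor"
    assume "inj_equiv U V" "inj_equiv V W"
    then show "inj_equiv U W"
      unfolding inj_equiv_def
      by (auto intro!: inj_norm_triangle_sub inj_null_mono[OF tendsto_add_zero,
            of "\<lambda>n. inj_norm (U n - V n)" "\<lambda>n. inj_norm (V n - W n)"])
  qed
qed

instantiation inj_tensor :: (real_normed_vector, real_normed_vector) real_normed_vector
begin

lift_definition zero_inj_tensor :: "('a, 'b) inj_tensor" is "\<lambda>_. 0"
  by (simp add: inj_equiv_refl inj_Cauchy_const)

lift_definition plus_inj_tensor ::
  "('a, 'b) inj_tensor \<Rightarrow> ('a, 'b) inj_tensor \<Rightarrow> ('a, 'b) inj_tensor" is "\<lambda>U V n. U n + V n"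
  by (rule inj_equiv_add)

lift_definition uminus_inj_tensor :: "('a, 'b) inj_tensor \<Rightarrow> ('a, 'b) inj_tensor" is
  "\<lambda>U n. - U n"
  by (rule inj_equiv_minus)

lift_definition minus_inj_tensor ::
  "('a, 'b) inj_tensor \<Rightarrow> ('a, 'b) inj_tensor \<Rightarrow> ('a, 'b) inj_tensor" is "\<lambda>U V n. U n - V n"
  by (rule inj_equiv_diff)

lift_definition scaleR_inj_tensor :: "real \<Rightarrow> ('a, 'b) inj_tensor \<Rightarrow> ('a, 'b) inj_tensor" is
  "\<lambda>r U n. r *\<^sub>R U n"
  by (rule inj_equiv_scaleR)

lift_definition norm_inj_tensor :: "('a, 'b) inj_tensor \<Rightarrow> real" is
  "\<lambda>U. lim (\<lambda>n. inj_norm (U n))"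
proof -
  fix U V :: "nat \<Rightarrow> ('a, 'b) tensor"
  assume UV: "inj_equiv U V"
  have "(\<lambda>n. inj_norm (U n) - inj_norm (V n)) \<longlonglongrightarrow> 0"
    by (rule Lim_null_comparison[where g = "\<lambda>n. inj_norm (U n - V n)"])
      (use UV in \<open>auto simp: inj_equiv_def inj_norm_reverse_triangle\<close>)
  moreover have "(\<lambda>n. inj_norm (U n) - inj_norm (V n))
      \<longlonglongrightarrow> lim (\<lambda>n. inj_norm (U n)) - lim (\<lambda>n. inj_norm (V n))"
    using UV by (intro tendsto_diff inj_Cauchy_norm_lim) (auto simp: inj_equiv_def)
  ultimately show "lim (\<lambda>n. inj_norm (U n)) = lim (\<lambda>n. inj_norm (V n))"
    using LIMSEQ_unique by fastforce
qed

definition dist_inj_tensor :: "('a, 'b) inj_tensor \<Rightarrow> ('a, 'b) inj_tensor \<Rightarrow> real" where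
  "dist_inj_tensor z w = norm (z - w)"

definition sgn_inj_tensor :: "('a, 'b) inj_tensor \<Rightarrow> ('a, 'b) inj_tensor" where
  "sgn_inj_tensor z = inverse (norm z) *\<^sub>R z"

definition uniformity_inj_tensor :: "(('a, 'b) inj_tensor \<times> ('a, 'b) inj_tensor) filter" where
  "uniformity_inj_tensor = (INF e\<in>{0<..}. principal {(z, w). dist z w < e})"

definition open_inj_tensor :: "('a, 'b) inj_tensor set \<Rightarrow> bool" where
  "open_inj_tensor S \<longleftrightarrow> (\<forall>z\<in>S. \<forall>\<^sub>F (z', w) in uniformity. z' = z \<longrightarrow> w \<in> S)"

instance
proof
  fix z w v :: "('a, 'b) inj_tensor" and r s :: real
  show "z + w + v = z + (w + v)"
    by transfer (auto simp: add.assoc intro!: inj_equiv_refl inj_Cauchy_add simp: inj_equiv_def)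
  show "z + w = w + z"
    by transfer (auto simp: add.commute intro!: inj_Cauchy_add simp: inj_equiv_def)
  show "0 + z = z"
    by transfer (auto simp: inj_equiv_def)
  show "- z + z = 0"
    by transfer (auto simp: inj_equiv_def inj_Cauchy_const)
  show "z - w = z + - w"
    by transfer (auto simp: inj_equiv_def inj_Cauchy_diff)
  show "r *\<^sub>R (z + w) = r *\<^sub>R z + r *\<^sub>R w"
    by transfer (auto simp: inj_equiv_def scaleR_add_right inj_Cauchy_add inj_Cauchy_scaleR)
  show "(r + s) *\<^sub>R z = r *\<^sub>R z + s *\<^sub>R z"
    by transfer (auto simp: inj_equiv_def scaleR_add_left inj_Cauchy_add inj_Cauchy_scaleR)
  show "r *\<^sub>R s *\<^sub>R z = (r * s) *\<^sub>R z"
    by transfer (auto simp: inj_equiv_def inj_Cauchy_scaleR)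
  show "1 *\<^sub>R z = z"
    by transfer (auto simp: inj_equiv_def)
  show "dist z w = norm (z - w)"
    by (rule dist_inj_tensor_def)
  show "sgn z = inverse (norm z) *\<^sub>R z"
    by (rule sgn_inj_tensor_def)
  show "uniformity =
      (INF e\<in>{0<..}. principal {(z, w :: ('a, 'b) inj_tensor). dist z w < e})"
    by (rule uniformity_inj_tensor_def)
  show "open S = (\<forall>z\<in>S. \<forall>\<^sub>F (z', w) in uniformity. z' = z \<longrightarrow> w \<in> S)"
    for S :: "('a, 'b) inj_tensor set"
    by (rule open_inj_tensor_def)
  show "norm z = 0 \<longleftrightarrow> z = 0"
  proof transfer
    fix U :: "nat \<Rightarrow> ('a, 'b) tensor"
    assume "inj_equiv U U"
    then have "inj_Cauchy U" by (simp add: inj_equiv_def)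
    then show "lim (\<lambda>n. inj_norm (U n)) = 0 \<longleftrightarrow> inj_equiv U (\<lambda>_. 0)"
      using inj_Cauchy_norm_lim[of U]
      by (auto simp: inj_equiv_def inj_Cauchy_const dest: limI)
  qed
  show "norm (z + w) \<le> norm z + norm w"
  proof transfer
    fix U V :: "nat \<Rightarrow> ('a, 'b) tensor"
    assume "inj_equiv U U" "inj_equiv V V"
    then have "inj_Cauchy U" "inj_Cauchy V" by (auto simp: inj_equiv_def)
    then show "lim (\<lambda>n. inj_norm (U n + V n))
        \<le> lim (\<lambda>n. inj_norm (U n)) + lim (\<lambda>n. inj_norm (V n))"
      by (intro LIMSEQ_le[OF inj_Cauchy_norm_lim tendsto_add[OF inj_Cauchy_norm_lim
              inj_Cauchy_norm_lim]] inj_Cauchy_add exI allI impI inj_norm_triangle)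
  qed
  show "norm (r *\<^sub>R z) = \<bar>r\<bar> * norm z"
  proof transfer
    fix r :: real and U :: "nat \<Rightarrow> ('a, 'b) tensor"
    assume "inj_equiv U U"
    then have "inj_Cauchy U" by (simp add: inj_equiv_def)
    then show "lim (\<lambda>n. inj_norm (r *\<^sub>R U n)) = \<bar>r\<bar> * lim (\<lambda>n. inj_norm (U n))"
      unfolding inj_norm_scaleR by (intro limI tendsto_mult_left inj_Cauchy_norm_lim)
  qed
qed

end

lift_definition of_tensor ::
  "('a::real_normed_vector, 'b::real_normed_vector) tensor \<Rightarrow> ('a, 'b) inj_tensor" is "\<lambda>u _. u"
  by (simp add: inj_equiv_refl inj_Cauchy_const)

lemma linear_of_tensor: "linear of_tensor"
  by (rule linearI; transfer) (simp_all add: inj_equiv_refl inj_Cauchy_const)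

lemma norm_of_tensor: "norm (of_tensor u) = inj_norm u"
  by transfer simp

lemma of_tensor_dense:
  fixes z :: "('a::real_normed_vector, 'b::real_normed_vector) inj_tensor"
  assumes "e > 0"
  obtains u where "norm (z - of_tensor u) < e"
proof -
  have "\<exists>u. norm (z - of_tensor u) < e"
    using assms
  proof transfer
    fix U :: "nat \<Rightarrow> ('a, 'b) tensor" and e :: real
    assume "inj_equiv U U" and e: "e > 0"
    then have U: "inj_Cauchy U" by (simp add: inj_equiv_def)
    have "e / 2 > 0" using e by simp
    with U obtain N where N: "\<forall>m\<ge>N. \<forall>n\<ge>N. inj_norm (U m - U n) < e / 2"
      unfolding inj_Cauchy_def by meson
    have "lim (\<lambda>n. inj_norm (U n - U N)) \<le> e / 2"
      by (rule LIMSEQ_le_const2[OF inj_Cauchy_norm_lim[OF inj_Cauchy_diff[OF U inj_Cauchy_const]]])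
        (use N in \<open>auto intro!: exI[of _ N] less_imp_le\<close>)
    with e show "\<exists>u. lim (\<lambda>n. inj_norm (U n - u)) < e"
      by (intro exI[of _ "U N"]) simp
  qed
  with that show thesis by blast
qed

lemma of_tensor_tendsto_abs:
  assumes "inj_Cauchy U"
  shows "(\<lambda>n. of_tensor (U n)) \<longlonglongrightarrow> abs_inj_tensor U"
proof (rule LIMSEQ_I)
  fix e :: real assume e: "e > 0"
  then have "e / 2 > 0" by simp
  with assms obtain N where N: "\<forall>m\<ge>N. \<forall>n\<ge>N. inj_norm (U m - U n) < e / 2"
    unfolding inj_Cauchy_def by meson
  have "norm (of_tensor (U n) - abs_inj_tensor U) < e" if "n \<ge> N" for n
  proof -
    have "norm (of_tensor (U n) - abs_inj_tensor U) = lim (\<lambda>m. inj_norm (U n - U m))"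
      using assms
      by (simp add: of_tensor.abs_eq minus_inj_tensor.abs_eq norm_inj_tensor.abs_eq
          inj_equiv_refl inj_Cauchy_const inj_Cauchy_diff)
    also have "\<dots> \<le> e / 2"
      by (rule LIMSEQ_le_const2[OF inj_Cauchy_norm_lim[OF inj_Cauchy_diff[OF inj_Cauchy_const assms]]])
        (use N that in \<open>auto intro!: exI[of _ N] less_imp_le\<close>)
    also have "\<dots> < e" using e by simp
    finally show ?thesis .
  qed
  then show "\<exists>N. \<forall>n\<ge>N. norm (of_tensor (U n) - abs_inj_tensor U) < e" by blast
qed

instance inj_tensor :: (real_normed_vector, real_normed_vector) banach
proof
  fix Z :: "nat \<Rightarrow> ('a, 'b) inj_tensor"
  assume Z: "Cauchy Z"
  have "\<exists>u. norm (Z n - of_tensor u) < inverse (real (Suc n))" for n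
    using of_tensor_dense[of "inverse (real (Suc n))" "Z n"]
    by (metis inverse_positive_iff_positive of_nat_0_less_iff zero_less_Suc)
  then obtain U where U: "\<And>n. norm (Z n - of_tensor (U n)) < inverse (real (Suc n))"
    by metis
  have null: "(\<lambda>n. Z n - of_tensor (U n)) \<longlonglongrightarrow> 0"
    by (rule Lim_null_comparison[OF _ LIMSEQ_inverse_real_of_nat])
      (use U in \<open>intro always_eventually allI less_imp_le\<close>)
  have "Cauchy (\<lambda>n. of_tensor (U n))"
  proof (rule CauchyI)
    fix e :: real assume "e > 0"
    then have e: "e / 3 > 0" by simp
    obtain M where M: "\<forall>m\<ge>M. \<forall>n\<ge>M. norm (Z m - Z n) < e / 3"
      using CauchyD[OF Z e] by blast
    obtain N where N: "\<forall>n\<ge>N. norm (Z n - of_tensor (U n)) < e / 3"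
      using LIMSEQ_D[OF null e] by auto
    have "norm (of_tensor (U m) - of_tensor (U n)) < e" if "m \<ge> max M N" "n \<ge> max M N" for m n
    proof -
      have "of_tensor (U m) - of_tensor (U n)
          = (Z m - Z n) - (Z m - of_tensor (U m)) + (Z n - of_tensor (U n))"
        by (simp add: algebra_simps)
      also have "norm \<dots> \<le>
          norm (Z m - Z n) + norm (Z m - of_tensor (U m)) + norm (Z n - of_tensor (U n))"
        by (intro norm_triangle_le add_right_mono norm_triangle_ineq4)
      also have "\<dots> < e / 3 + e / 3 + e / 3"
        using M N that by (intro add_strict_mono) auto
      finally show ?thesis by simp
    qed
    then show "\<exists>M. \<forall>m\<ge>M. \<forall>n\<ge>M. norm (of_tensor (U m) - of_tensor (U n)) < e" by blast
  qed
  then have "inj_Cauchy U"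
    unfolding Cauchy_def inj_Cauchy_def
    by (simp add: dist_norm norm_of_tensor flip: linear_diff[OF linear_of_tensor])
  then have "(\<lambda>n. of_tensor (U n) + (Z n - of_tensor (U n))) \<longlonglongrightarrow> abs_inj_tensor U + 0"
    by (intro tendsto_add of_tensor_tendsto_abs null)
  then show "convergent Z"
    by (auto simp: convergent_def)
qed

section \<open>Roughness\<close>

definition roughness_at :: "'z::real_normed_vector \<Rightarrow> ereal" where
  "roughness_at u = Limsup (at 0) (\<lambda>h. ereal ((norm (u + h) + norm (u - h) - 2) / norm h))"

definition eps_rough_norm :: "'z::real_normed_vector itself \<Rightarrow> real \<Rightarrow> bool" where
  "eps_rough_norm (Z :: 'z itself) \<epsilon> \<longleftrightarrow> (\<forall>u \<in> sphere (0 :: 'z) 1. ereal \<epsilon> \<le> roughness_at u)"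

definition rough_norm :: "'z::real_normed_vector itself \<Rightarrow> bool" where
  "rough_norm Z \<longleftrightarrow> (\<exists>\<epsilon>>0. eps_rough_norm Z \<epsilon>)"

abbreviation non_rough_norm :: "'z::real_normed_vector itself \<Rightarrow> bool" where
  "non_rough_norm Z \<equiv> \<not> rough_norm Z"

end

theory Submission
  imports Defs
begin

text \<open>
  Everything rests on testing tensors against pairs \<open>(\<phi>, \<psi>)\<close> of functionals of norm one.

  Suppose that \<open>X\<close> is rough and let \<open>z\<close> be a unit tensor. Some pair \<open>(\<phi>, \<psi>)\<close> takes a value close to
  one at \<open>z\<close>, and contracting \<open>z\<close> by \<open>\<psi>\<close> gives a vector \<open>x\<close> of \<open>X\<close> of norm close to one. Contraction by
  \<open>\<psi>\<close> does not increase norms, and if \<open>\<psi> y = 1\<close>, it sends \<open>z + h \<otimes> y\<close> to \<open>x + h\<close>; so a direction \<open>h\<close>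
  in which the norm of \<open>X\<close> is rough at \<open>x\<close> gives the direction \<open>h \<otimes> y\<close> at \<open>z\<close>. The choice of \<open>x\<close> costs
  an error that must be small relative to the size of \<open>h\<close>. This is not circular, because by
  convexity the difference quotients grow with the size of the increment
  (\<open>symmetric_increment_mono\<close>): for a rough norm, every nonzero point has, for every
  prescribed size, an increment of that size with large difference quotient (\<open>eps_rough_increment\<close>), so the size is fixed first, and then the error,
  and then \<open>x\<close>. The argument is \<open>rough_norm_transfer\<close>; by symmetry it applies to \<open>Y\<close>.

  Suppose that \<open>X\<close> and \<open>Y\<close> are non-rough, and take unit vectors \<open>x\<close> and \<open>y\<close> at which the roughness
  is small. Then all functionals of norm one with value close to one at \<open>x\<close> are close to one another,
  and likewise at \<open>y\<close> (\<open>functionals_close\<close>). For small \<open>h\<close>, pairs that nearly norm \<open>x \<otimes> y + h\<close> and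
  \<open>x \<otimes> y - h\<close> have, up to a common sign, components of this kind (\<open>nearly_norming_near_tensor\<close>),
  so their values at \<open>h\<close> almost cancel. This bounds the roughness at \<open>x \<otimes> y\<close>
  (\<open>roughness_at_tensor_le\<close>).

  That norms can be computed with functionals is the Hahn-Banach theorem. It is proved here
  from the fact that a minimal sublinear functional is linear.
\<close>

section \<open>Norming functionals\<close>

text \<open>
  Homogeneity is stated as an inequality for positive scalars, which passes directly to
  infima; applied to \<open>r\<close> and to \<open>1 / r\<close> it gives equality, also at \<open>r = 0\<close>.
\<close>

definition sublinear :: "('a::real_vector \<Rightarrow> real) \<Rightarrow> bool" where
  "sublinear p \<longleftrightarrow>
    (\<forall>x y. p (x + y) \<le> p x + p y) \<and> (\<forall>r>0. \<forall>x. p (r *\<^sub>R x) \<le> r * p x)"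

lemma sublinear_add: "sublinear p \<Longrightarrow> p (x + y) \<le> p x + p y"
  by (simp add: sublinear_def)

lemma sublinear_zero:
  assumes "sublinear p"
  shows "p 0 = 0"
proof -
  have "p (2 *\<^sub>R 0) \<le> 2 * p 0" "p ((1/2) *\<^sub>R 0) \<le> (1/2) * p 0"
    using assms unfolding sublinear_def by (metis zero_less_numeral, metis half_gt_zero zero_less_one)
  then show ?thesis by simp
qed

lemma sublinear_scaleR:
  assumes "sublinear p" "r \<ge> 0"
  shows "p (r *\<^sub>R x) = r * p x"
proof (cases "r = 0")
  case True
  then show ?thesis using sublinear_zero[OF assms(1)] by simp
next
  case False
  then have r: "r > 0" using assms by simp
  have "p ((1/r) *\<^sub>R (r *\<^sub>R x)) \<le> (1/r) * p (r *\<^sub>R x)"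
    using assms r unfolding sublinear_def by (metis zero_less_divide_1_iff)
  then have "r * p x \<le> p (r *\<^sub>R x)" using r by (simp add: field_simps)
  moreover have "p (r *\<^sub>R x) \<le> r * p x"
    using assms r unfolding sublinear_def by blast
  ultimately show ?thesis by simp
qed

lemma sublinear_lower: "sublinear p \<Longrightarrow> - p (- x) \<le> p x"
  using sublinear_add[of p x "- x"] sublinear_zero[of p] by simp

lemma sublinear_norm: "sublinear norm"
  by (simp add: sublinear_def norm_triangle_ineq)

text \<open>
  For sublinear \<open>p\<close>, the largest sublinear \<open>q \<le> p\<close> with \<open>q (- a) \<le> - p a\<close>. A sublinear
  functional is linear exactly if these operations cannot make it smaller.
\<close>

definition shrink :: "('a::real_vector \<Rightarrow> real) \<Rightarrow> 'a \<Rightarrow> 'a \<Rightarrow> real" where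
  "shrink p a x = (INF t\<in>{0..}. p (x + t *\<^sub>R a) - t * p a)"

lemma shrink_le:
  assumes "sublinear p" "t \<ge> 0"
  shows "shrink p a x \<le> p (x + t *\<^sub>R a) - t * p a"
  unfolding shrink_def
proof (rule cINF_lower)
  have "- p (- x) \<le> p (x + s *\<^sub>R a) - s * p a" if "s \<ge> 0" for s
    using sublinear_add[OF assms(1), of "x + s *\<^sub>R a" "- x"] sublinear_scaleR[OF assms(1) that, of a]
    by simp
  then show "bdd_below ((\<lambda>t. p (x + t *\<^sub>R a) - t * p a) ` {0..})"
    by (intro bdd_belowI[where m = "- p (- x)"]) auto
qed (use assms in auto)

lemma shrink_greatest:
  "(\<And>t. t \<ge> 0 \<Longrightarrow> c \<le> p (x + t *\<^sub>R a) - t * p a) \<Longrightarrow> c \<le> shrink p a x"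
  unfolding shrink_def by (rule cINF_greatest) auto

lemma shrink_le_self: "sublinear p \<Longrightarrow> shrink p a x \<le> p x"
  using shrink_le[of p 0 a x] by simp

lemma sublinear_shrink:
  assumes p: "sublinear p"
  shows "sublinear (shrink p a)"
  unfolding sublinear_def
proof (intro conjI allI impI)
  fix x y
  have "shrink p a (x + y) - (p (y + s *\<^sub>R a) - s * p a) \<le> p (x + t *\<^sub>R a) - t * p a"
    if "s \<ge> 0" "t \<ge> 0" for s t
    using shrink_le[OF p, of "s + t" a "x + y"] that
      sublinear_add[OF p, of "x + t *\<^sub>R a" "y + s *\<^sub>R a"]
    by (simp add: algebra_simps)
  then have "shrink p a (x + y) - (p (y + s *\<^sub>R a) - s * p a) \<le> shrink p a x" if "s \<ge> 0" for s
    using that by (intro shrink_greatest) auto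
  then have "shrink p a (x + y) - shrink p a x \<le> shrink p a y"
    by (intro shrink_greatest) (auto simp: algebra_simps)
  then show "shrink p a (x + y) \<le> shrink p a x + shrink p a y" by simp
next
  fix r :: real and x assume r: "r > 0"
  have "shrink p a (r *\<^sub>R x) / r \<le> shrink p a x"
  proof (rule shrink_greatest)
    fix t :: real assume t: "t \<ge> 0"
    have "shrink p a (r *\<^sub>R x) \<le> p (r *\<^sub>R (x + t *\<^sub>R a)) - (r * t) * p a"
      using shrink_le[OF p, of "r * t" a "r *\<^sub>R x"] r t by (simp add: scaleR_add_right)
    also have "\<dots> = r * (p (x + t *\<^sub>R a) - t * p a)"
      using sublinear_scaleR[OF p, of r "x + t *\<^sub>R a"] r by (simp add: algebra_simps)
    finally show "shrink p a (r *\<^sub>R x) / r \<le> p (x + t *\<^sub>R a) - t * p a"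
      using r by (simp add: field_simps)
  qed
  then show "shrink p a (r *\<^sub>R x) \<le> r * shrink p a x"
    using r by (simp add: field_simps)
qed

text \<open>
  A minimal \<open>p\<close> equals all its shrinkings, and \<open>p (x + y) - p y\<close> is one of the terms in the
  infimum that defines \<open>shrink p y x\<close>, so it is at least \<open>p x\<close>.
\<close>

lemma linear_if_minimal:
  fixes p :: "'a::real_vector \<Rightarrow> real"
  assumes p: "sublinear p"
    and minimal: "\<And>q. sublinear q \<Longrightarrow> (\<And>x. q x \<le> p x) \<Longrightarrow> q = p"
  shows "linear p"
proof (rule linearI)
  have eq: "shrink p a = p" for a
    by (rule minimal) (simp_all add: sublinear_shrink shrink_le_self p)
  show add: "p (x + y) = p x + p y" for x y
    using shrink_le[OF p, of 1 y x] sublinear_add[OF p, of x y] by (simp add: eq)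
  have neg: "p (- x) = - p x" for x
    using add[of x "- x"] sublinear_zero[OF p] by simp
  show "p (r *\<^sub>R x) = r *\<^sub>R p x" for r x
    using sublinear_scaleR[OF p, of r x] sublinear_scaleR[OF p, of "- r" x] neg[of "r *\<^sub>R x"]
    by (cases "r \<ge> 0") auto
qed

text \<open>
  A minimal sublinear functional below \<open>p0\<close> exists by Zorn's lemma: the pointwise infimum of
  a chain is finite, since \<open>- p0 (- x)\<close> bounds all values at \<open>x\<close> from below, and
  subadditivity survives because two members of a chain have a common lower bound among them.
\<close>

lemma linear_below_sublinear:
  fixes p0 :: "'a::real_vector \<Rightarrow> real"
  assumes p0: "sublinear p0"
  obtains f where "linear f" "\<And>x. f x \<le> p0 x"
proof -
  define A where "A = {p. sublinear p \<and> p \<le> p0}"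
  define P where "P = (\<lambda>p q :: 'a \<Rightarrow> real. q \<le> p)"
  have "\<exists>m\<in>A. \<forall>q\<in>A. P m q \<longrightarrow> q = m"
  proof (rule predicate_Zorn)
    show "partial_order_on A (relation_of P A)"
      by (rule partial_order_on_relation_ofI) (auto simp: P_def)
  next
    fix C assume C: "C \<in> Chains (relation_of P A)"
    show "\<exists>u\<in>A. \<forall>p\<in>C. P p u"
    proof (cases "C = {}")
      case True
      then show ?thesis using p0 by (auto simp: A_def)
    next
      case False
      have CA: "sublinear p" "p x \<le> p0 x" if "p \<in> C" for p x
        using that C by (auto simp: Chains_def relation_of_def A_def le_fun_def)
      have tot: "p \<le> q \<or> q \<le> p" if "p \<in> C" "q \<in> C" for p q
        using that C by (auto simp: Chains_def relation_of_def P_def)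
      define u where "u x = (INF p\<in>C. p x)" for x
      have lower: "u x \<le> p x" if "p \<in> C" for p x
        unfolding u_def
      proof (rule cINF_lower[OF _ that])
        have "- p0 (- x) \<le> p x" if "p \<in> C" for p
          using sublinear_lower[OF CA(1)[OF that], of x] CA(2)[OF that, of "- x"] by simp
        then show "bdd_below ((\<lambda>p. p x) ` C)" by (rule bdd_belowI2)
      qed
      have greatest: "c \<le> u x" if "\<And>p. p \<in> C \<Longrightarrow> c \<le> p x" for c x
        unfolding u_def by (rule cINF_greatest[OF False that])
      have "sublinear u"
        unfolding sublinear_def
      proof (intro conjI allI impI)
        fix x y
        have "u (x + y) - q y \<le> p x" if pq: "p \<in> C" "q \<in> C" for p q
        proof -
          obtain w where w: "w \<in> C" "w \<le> p" "w \<le> q" using tot[OF pq] pq by auto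
          have "u (x + y) \<le> w x + w y"
            using lower[OF w(1), of "x + y"] sublinear_add[OF CA(1)[OF w(1)], of x y] by simp
          then show ?thesis using w(2,3) by (smt (verit) le_funD)
        qed
        then have "u (x + y) - q y \<le> u x" if "q \<in> C" for q
          using that by (intro greatest) auto
        then have "u (x + y) - u x \<le> u y"
          by (intro greatest) (auto simp: algebra_simps)
        then show "u (x + y) \<le> u x + u y" by simp
      next
        fix r :: real and x assume r: "r > 0"
        have "u (r *\<^sub>R x) / r \<le> u x"
          by (rule greatest)
            (use r lower[of _ "r *\<^sub>R x"] sublinear_scaleR[OF CA(1), of _ r x] in
              \<open>auto simp: field_simps\<close>)
        then show "u (r *\<^sub>R x) \<le> r * u x" using r by (simp add: field_simps)
      qed
      moreover have "u \<le> p0"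
        using False lower CA(2) by (fastforce simp: le_fun_def intro: order.trans)
      ultimately show ?thesis
        using lower by (auto simp: A_def P_def le_fun_def intro!: bexI[of _ u])
    qed
  qed
  then obtain m where m: "sublinear m" "m \<le> p0" "\<And>q. sublinear q \<Longrightarrow> q \<le> m \<Longrightarrow> q = m"
    unfolding A_def P_def by (smt (verit) mem_Collect_eq order.trans)
  have "linear m"
    using m(1,3) by (intro linear_if_minimal) (auto simp: le_fun_def)
  with m(2) show thesis by (intro that[of m]) (auto simp: le_fun_def)
qed

text \<open>
  Shrinking the norm along \<open>a\<close> before taking a linear functional below it forces the value
  at \<open>- a\<close> down to \<open>- norm a\<close>.
\<close>

lemma norming_functional:
  fixes a :: "'a::real_normed_vector"
  assumes "a \<noteq> 0"
  obtains \<phi> :: "'a \<Rightarrow>\<^sub>L real" where "norm \<phi> = 1" "\<phi> a = norm a"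
proof -
  obtain f where f: "linear f" "\<And>x. f x \<le> shrink norm a x"
    using linear_below_sublinear[OF sublinear_shrink[OF sublinear_norm]] by blast
  have le: "f x \<le> norm x" for x
    using f(2)[of x] shrink_le_self[OF sublinear_norm, of a x] by simp
  have abs: "\<bar>f x\<bar> \<le> norm x" for x
    using le[of x] le[of "- x"] linear_neg[OF f(1), of x] by auto
  have "f (- a) \<le> - norm a"
    using f(2)[of "- a"] shrink_le[OF sublinear_norm, of 1 a "- a"] by simp
  then have fa: "f a = norm a"
    using le[of a] linear_neg[OF f(1), of a] by simp
  have bl: "bounded_linear f"
    by (rule bounded_linear_intro[where K = 1])
      (use f(1) abs in \<open>auto simp: linear_add linear_scale\<close>)
  define \<phi> where "\<phi> = Blinfun f"
  have \<phi>: "blinfun_apply \<phi> = f"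
    using bl by (simp add: \<phi>_def bounded_linear_Blinfun_apply)
  have "norm \<phi> \<le> 1"
    by (rule norm_blinfun_bound) (auto simp: \<phi> abs)
  moreover have "norm a \<le> norm \<phi> * norm a"
    using norm_blinfun[of \<phi> a] by (simp add: \<phi> fa)
  then have "1 \<le> norm \<phi>" using assms by simp
  ultimately show thesis by (intro that[of \<phi>]) (auto simp: \<phi> fa)
qed

lemma norm_le_if_functionals_le:
  fixes x :: "'a::real_normed_vector"
  assumes "0 \<le> B"
    and le: "\<And>\<phi> :: 'a \<Rightarrow>\<^sub>L real. norm \<phi> = 1 \<Longrightarrow> blinfun_apply \<phi> x \<le> B"
  shows "norm x \<le> B"
proof (cases "x = 0")
  case False
  then obtain \<phi> :: "'a \<Rightarrow>\<^sub>L real" where "norm \<phi> = 1" "\<phi> x = norm x"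
    by (rule norming_functional)
  then show ?thesis using le[of \<phi>] by simp
qed (use assms in simp)

lemma functional_attains_one:
  fixes \<psi> :: "'a::real_normed_vector \<Rightarrow>\<^sub>L real"
  assumes "norm \<psi> = 1"
  obtains y where "norm y \<le> 2" "\<psi> y = 1"
proof -
  have "\<exists>y. norm (\<psi> y) > 1 / 2 * norm y"
    using norm_blinfun_bound[of "1 / 2" \<psi>] assms by (force simp: not_le)
  then obtain y where y: "norm (\<psi> y) > 1 / 2 * norm y" ..
  then have "\<psi> y \<noteq> 0" by auto
  with y show thesis
    by (intro that[of "(1 / \<psi> y) *\<^sub>R y"]) (auto simp: blinfun.scaleR_right field_simps)
qed


section \<open>Roughness and increments of a fixed size\<close>

lemma roughness_at_lessD:
  fixes u :: "'a::real_normed_vector"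
  assumes "norm u = 1" "roughness_at u < ereal e"
  obtains r where "r > 0" "\<And>h. norm h < r \<Longrightarrow> norm (u + h) + norm (u - h) \<le> 2 + e * norm h"
proof -
  have "\<forall>\<^sub>F h in at 0. ereal ((norm (u + h) + norm (u - h) - 2) / norm h) < ereal e"
    using assms(2) unfolding roughness_at_def by (rule Limsup_lessD)
  then obtain r where r: "r > 0"
    and lt: "\<And>h. h \<noteq> 0 \<Longrightarrow> norm h < r \<Longrightarrow> (norm (u + h) + norm (u - h) - 2) / norm h < e"
    unfolding eventually_at by (auto simp: dist_norm)
  have "norm (u + h) + norm (u - h) \<le> 2 + e * norm h" if "norm h < r" for h
    using lt[OF _ that] assms(1) by (cases "h = 0") (auto simp: field_simps)
  with r show thesis by (rule that)
qed

text \<open>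
  The left-hand side is convex in \<open>s\<close> and vanishes at \<open>s = 0\<close>.
\<close>

lemma symmetric_increment_mono:
  fixes u h :: "'a::real_normed_vector"
  assumes "0 \<le> s" "s \<le> 1"
  shows "norm (u + s *\<^sub>R h) + norm (u - s *\<^sub>R h) - 2 * norm u
    \<le> s * (norm (u + h) + norm (u - h) - 2 * norm u)"
proof -
  have "u + s *\<^sub>R h = (1 - s) *\<^sub>R u + s *\<^sub>R (u + h)" "u - s *\<^sub>R h = (1 - s) *\<^sub>R u + s *\<^sub>R (u - h)"
    by (simp_all add: algebra_simps)
  then have "norm (u + s *\<^sub>R h) \<le> (1 - s) * norm u + s * norm (u + h)"
    "norm (u - s *\<^sub>R h) \<le> (1 - s) * norm u + s * norm (u - h)"
    using assms norm_triangle_ineq[of "(1 - s) *\<^sub>R u" "s *\<^sub>R (u + h)"]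
      norm_triangle_ineq[of "(1 - s) *\<^sub>R u" "s *\<^sub>R (u - h)"] by simp_all
  then show ?thesis by (simp add: algebra_simps)
qed

text \<open>
  By convexity, the difference quotients at increments of one size \<open>r\<close> bound those at all
  smaller ones, so that a limit superior is controlled by a single sphere.
\<close>

lemma roughness_at_leI:
  fixes u :: "'a::real_normed_vector"
  assumes u: "norm u = 1" and r: "r > 0"
    and le: "\<And>h. norm h = r \<Longrightarrow> norm (u + h) + norm (u - h) \<le> 2 + e * r"
  shows "roughness_at u \<le> ereal e"
  unfolding roughness_at_def
proof (rule Limsup_bounded)
  have "(norm (u + h) + norm (u - h) - 2) / norm h \<le> e" if h: "h \<noteq> 0" "norm h < r" for h
  proof -
    define s where "s = norm h / r"
    define k where "k = (1 / s) *\<^sub>R h"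
    have s: "0 < s" "s \<le> 1" using h r by (auto simp: s_def)
    have "norm k = r" using h r by (simp add: k_def s_def)
    moreover have "h = s *\<^sub>R k" using s by (simp add: k_def)
    ultimately have "norm (u + h) + norm (u - h) - 2 \<le> s * (norm (u + k) + norm (u - k) - 2)"
      using symmetric_increment_mono[of s u k] s u by simp
    also have "\<dots> \<le> s * (e * r)"
      using le[OF \<open>norm k = r\<close>] s by (intro mult_left_mono) auto
    also have "\<dots> = e * norm h" using r by (simp add: s_def)
    finally show ?thesis using h by (simp add: field_simps)
  qed
  then show "\<forall>\<^sub>F h in at 0. ereal ((norm (u + h) + norm (u - h) - 2) / norm h) \<le> ereal e"
    using r unfolding eventually_at by (auto simp: dist_norm)
qed

text \<open>
  The contrapositive of the previous lemma, applied to the normalized vector: a rough norm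
  has, at every nonzero point, increments of every size, however large, with large difference
  quotient.
\<close>

lemma eps_rough_increment:
  fixes x :: "'a::real_normed_vector"
  assumes rough: "eps_rough_norm TYPE('a) e" and "e' < e" "x \<noteq> 0" "t > 0"
  obtains h where "norm h = t" "norm (x + h) + norm (x - h) > 2 * norm x + e' * t"
proof -
  define u where "u = sgn x"
  have u: "norm u = 1" using assms by (simp add: u_def norm_sgn)
  then have "\<not> roughness_at u \<le> ereal e'"
    using rough \<open>e' < e\<close> unfolding eps_rough_norm_def
    by (metis dist_0_norm ereal_less_eq(3) mem_sphere not_le order.trans)
  then obtain k where k: "norm k = t / norm x"
    "norm (u + k) + norm (u - k) > 2 + e' * (t / norm x)"
    using roughness_at_leI[OF u, of "t / norm x" e'] assms by (meson divide_pos_pos not_le zero_less_norm_iff)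
  define h where "h = norm x *\<^sub>R k"
  have x: "x = norm x *\<^sub>R u" using \<open>x \<noteq> 0\<close> by (simp add: u_def sgn_div_norm)
  have "norm (x + h) = norm x * norm (u + k)" "norm (x - h) = norm x * norm (u - k)"
    by (subst x, simp add: h_def u flip: scaleR_add_right scaleR_diff_right)+
  moreover have "norm x * (norm (u + k) + norm (u - k)) > norm x * (2 + e' * (t / norm x))"
    using k assms by (intro mult_strict_left_mono) auto
  ultimately have "norm (x + h) + norm (x - h) > 2 * norm x + e' * t"
    using assms by (simp add: algebra_simps)
  moreover have "norm h = t" using k assms by (simp add: h_def)
  ultimately show thesis by (rule that[rotated])
qed

text \<open>
  Here \<open>x\<close> stands for the image of \<open>z\<close> under a contraction, up to an error \<open>\<tau>\<close>, and \<open>J\<close> lifts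
  increments back. The error may depend on the size \<open>t\<close> of the increment, because \<open>t\<close> can be
  prescribed before \<open>x\<close> is known.
\<close>

lemma rough_norm_transfer:
  assumes rough: "rough_norm TYPE('x::real_normed_vector)"
    and sections: "\<And>(z :: 'z::real_normed_vector) \<tau>. norm z = 1 \<Longrightarrow> 0 < \<tau> \<Longrightarrow> \<tau> < 1 \<Longrightarrow>
      \<exists>(x :: 'x) J. norm x \<ge> 1 - \<tau> \<and> (\<forall>h. norm (J h) \<le> 2 * norm h \<and>
        norm (x + h) \<le> norm (z + J h) + \<tau> \<and> norm (x - h) \<le> norm (z - J h) + \<tau>)"
  shows "rough_norm TYPE('z)"
proof -
  obtain e where e: "e > 0" "eps_rough_norm TYPE('x) e"
    using rough by (auto simp: rough_norm_def)
  have "ereal (e / 8) \<le> roughness_at z" if z: "norm z = 1" for z :: 'z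
  proof (rule ccontr)
    assume "\<not> ereal (e / 8) \<le> roughness_at z"
    then obtain r where r: "r > 0"
      and flat: "\<And>h. norm h < r \<Longrightarrow> norm (z + h) + norm (z - h) \<le> 2 + e / 8 * norm h"
      using roughness_at_lessD[OF z, of "e / 8"] by (metis not_le)
    \<comment> \<open>Small enough that increments of norm \<open>2 * t\<close> stay below \<open>r\<close>.\<close>
    define t where "t = r / 3"
    \<comment> \<open>The roughness of \<open>x\<close> yields an excess of \<open>e * t / 2\<close>, the flatness at \<open>z\<close> allows \<open>e * t / 4\<close>
      because \<open>J\<close> may double norms, and the passage from \<open>x\<close> to \<open>z\<close> costs at most \<open>4 * \<tau>\<close>.\<close>
    define \<tau> where "\<tau> = min (1 / 2) (e * t / 16)"
    have t: "t > 0" and \<tau>: "0 < \<tau>" "\<tau> < 1" "16 * \<tau> \<le> e * t"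
      using r e by (auto simp: t_def \<tau>_def)
    obtain x :: 'x and J where x: "norm x \<ge> 1 - \<tau>"
      and J: "\<And>h. norm (J h) \<le> 2 * norm h"
        "\<And>h. norm (x + h) \<le> norm (z + J h) + \<tau>" "\<And>h. norm (x - h) \<le> norm (z - J h) + \<tau>"
      using sections[OF z \<tau>(1,2)] by blast
    have "x \<noteq> 0" using x \<tau> by auto
    then obtain h where h: "norm h = t" "norm (x + h) + norm (x - h) > 2 * norm x + e / 2 * t"
      using eps_rough_increment[OF e(2), of "e / 2" x t] e t by auto
    have "norm (J h) \<le> 2 * t" using J(1)[of h] h by simp
    then have "norm (z + J h) + norm (z - J h) \<le> 2 + e / 8 * norm (J h)"
      using flat[of "J h"] r by (auto simp: t_def)
    also have "\<dots> \<le> 2 + e / 8 * (2 * t)"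
      using \<open>norm (J h) \<le> 2 * t\<close> e by (intro add_left_mono mult_left_mono) auto
    finally show False
      using h(2) x J(2,3)[of h] \<tau>(3) mult_pos_pos[OF e(1) t] by simp
  qed
  then show ?thesis
    using e unfolding rough_norm_def eps_rough_norm_def
    by (intro exI[of _ "e / 8"]) auto
qed

text \<open>
  The dual description of small roughness: for \<open>\<phi>\<close> and \<open>\<phi>'\<close> of norm at most one,
  \<open>\<phi> (x + k) + \<phi>' (x - k)\<close> is at most \<open>norm (x + k) + norm (x - k)\<close>, so flatness of the norm
  at \<open>x\<close> bounds \<open>(\<phi> - \<phi>') k\<close> if both functionals nearly attain one at \<open>x\<close>.
\<close>

lemma functionals_close:
  fixes x :: "'a::real_normed_vector"
  assumes x: "norm x = 1" and e: "e > 0" and flat: "roughness_at x < ereal e"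
  obtains \<delta> where "\<delta> > 0"
    "\<And>\<phi> \<phi>' :: 'a \<Rightarrow>\<^sub>L real. norm \<phi> \<le> 1 \<Longrightarrow> norm \<phi>' \<le> 1 \<Longrightarrow>
      blinfun_apply \<phi> x > 1 - \<delta> \<Longrightarrow> blinfun_apply \<phi>' x > 1 - \<delta> \<Longrightarrow> norm (\<phi> - \<phi>') \<le> 2 * e"
proof -
  obtain r where r: "r > 0"
    and le: "\<And>h. norm h < r \<Longrightarrow> norm (x + h) + norm (x - h) \<le> 2 + e * norm h"
    using roughness_at_lessD[OF x flat] by blast
  define t where "t = r / 2"
  have t: "0 < t" "t < r" using r by (auto simp: t_def)
  have "norm (\<phi> - \<phi>') \<le> 2 * e"
    if n: "norm \<phi> \<le> 1" "norm \<phi>' \<le> 1"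
      and a: "blinfun_apply \<phi> x > 1 - e * t / 2" "blinfun_apply \<phi>' x > 1 - e * t / 2"
    for \<phi> \<phi>' :: "'a \<Rightarrow>\<^sub>L real"
  proof (rule norm_blinfun_bound)
    have le_norm: "blinfun_apply \<phi> v \<le> norm v" if "norm \<phi> \<le> 1" for \<phi> :: "'a \<Rightarrow>\<^sub>L real" and v
      using norm_blinfun[of \<phi> v] mult_right_mono[OF that, of "norm v"] by simp
    have bound: "(\<phi> - \<phi>') h \<le> 2 * e * norm h" for h
    proof (cases "h = 0")
      case False
      define k where "k = (t / norm h) *\<^sub>R h"
      have k: "norm k = t" using False t by (simp add: k_def)
      have "\<phi> (x + k) + \<phi>' (x - k) \<le> 2 + e * t"
        using le_norm[OF n(1), of "x + k"] le_norm[OF n(2), of "x - k"] le[of k] k t by simp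
      then have "(\<phi> - \<phi>') k \<le> 2 * e * t"
        using a by (simp add: blinfun.add_right blinfun.diff_right blinfun.diff_left)
      then have "(t / norm h) * (\<phi> - \<phi>') h \<le> 2 * e * t"
        by (simp add: k_def blinfun.scaleR_right)
      then show ?thesis using False t by (simp add: field_simps)
    qed simp
    show "norm ((\<phi> - \<phi>') h) \<le> 2 * e * norm h" for h
      using bound[of h] bound[of "- h"] by (simp add: blinfun.minus_right)
  qed (use e in simp)
  with e t show thesis by (intro that[of "e * t / 2"]) auto
qed

section \<open>Contractions and bilinear evaluation of tensors\<close>

lemma tensor_induct [case_names tensor add]:
  fixes u :: "('a::real_vector, 'b::real_vector) tensor"
  assumes tensor: "\<And>x y. P (tensor x y)"
    and add: "\<And>u v. P u \<Longrightarrow> P v \<Longrightarrow> P (u + v)"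
  shows "P u"
proof (induction u rule: tensor.abs_induct)
  fix f :: "'a \<times> 'b \<Rightarrow>\<^sub>0 real"
  show "P (abs_tensor f)"
  proof (induction f rule: update_induct)
    case const
    have "abs_tensor 0 = tensor (0 :: 'a) (0 :: 'b)"
      using tensor_scaleR_left[of 0 "0 :: 'a" "0 :: 'b"] by (simp add: zero_tensor_def)
    then show ?case using tensor[of 0 0] by simp
  next
    case (update f p c)
    obtain x y where p: "p = (x, y)" by (cases p)
    have "Poly_Mapping.update p c f = free_scale c (free_gen x y) + f"
      using update(1) unfolding p
      by (intro poly_mapping_eqI)
        (auto simp: lookup_add lookup_update free_gen_def lookup_single when_def in_keys_iff)
    moreover have "abs_tensor (free_scale c (free_gen x y)) = tensor (c *\<^sub>R x) y"
      unfolding tensor_scaleR_left by (simp add: tensor.abs_eq scaleR_tensor.abs_eq)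
    ultimately have "abs_tensor (Poly_Mapping.update p c f) = tensor (c *\<^sub>R x) y + abs_tensor f"
      by (simp flip: plus_tensor.abs_eq)
    then show ?case using update(3) tensor add by simp
  qed
qed

lemma tensor_eval_add_left:
  "tensor_eval (\<phi> + \<phi>') \<psi> u = tensor_eval \<phi> \<psi> u + tensor_eval \<phi>' \<psi> u"
  by (induction u rule: tensor_induct)
    (simp_all add: blinfun.add_left tensor_eval_add distrib_right)

lemma tensor_eval_add_right:
  "tensor_eval \<phi> (\<psi> + \<psi>') u = tensor_eval \<phi> \<psi> u + tensor_eval \<phi> \<psi>' u"
  by (induction u rule: tensor_induct)
    (simp_all add: blinfun.add_left tensor_eval_add distrib_left)

lemma tensor_eval_scaleR_left: "tensor_eval (r *\<^sub>R \<phi>) \<psi> u = r * tensor_eval \<phi> \<psi> u"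
  by (induction u rule: tensor_induct)
    (simp_all add: blinfun.scaleR_left tensor_eval_add distrib_left)

lemma tensor_eval_scaleR_right: "tensor_eval \<phi> (r *\<^sub>R \<psi>) u = r * tensor_eval \<phi> \<psi> u"
  by (induction u rule: tensor_induct)
    (simp_all add: blinfun.scaleR_left tensor_eval_add distrib_left)

lemma tensor_eval_minus_left: "tensor_eval (- \<phi>) \<psi> u = - tensor_eval \<phi> \<psi> u"
  using tensor_eval_scaleR_left[of "-1" \<phi> \<psi> u] by simp

lemma tensor_eval_minus_right: "tensor_eval \<phi> (- \<psi>) u = - tensor_eval \<phi> \<psi> u"
  using tensor_eval_scaleR_right[of \<phi> "-1" \<psi> u] by simp

text \<open>
  The witness is the contraction of \<open>u\<close> by \<open>\<psi>\<close>, which takes \<open>tensor x y\<close> to \<open>\<psi> y *\<^sub>R x\<close>.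
\<close>

lemma contraction_left: "\<exists>x. \<forall>\<phi>. blinfun_apply \<phi> x = tensor_eval \<phi> \<psi> u"
proof (induction u rule: tensor_induct)
  case (tensor x y)
  show ?case by (rule exI[of _ "\<psi> y *\<^sub>R x"]) (simp add: blinfun.scaleR_right)
next
  case (add u v)
  then show ?case by (metis blinfun.add_right tensor_eval_add)
qed

lemma contraction_right: "\<exists>y. \<forall>\<psi>. blinfun_apply \<psi> y = tensor_eval \<phi> \<psi> u"
proof (induction u rule: tensor_induct)
  case (tensor x y)
  show ?case by (rule exI[of _ "\<phi> x *\<^sub>R y"]) (simp add: blinfun.scaleR_right)
next
  case (add u v)
  then show ?case by (metis blinfun.add_right tensor_eval_add)
qed

lemma tensor_eval_le: "\<bar>tensor_eval \<phi> \<psi> u\<bar> \<le> norm \<phi> * norm \<psi> * inj_norm u"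
proof (cases "\<phi> = 0 \<or> \<psi> = 0")
  case True
  then show ?thesis
    using tensor_eval_scaleR_left[of 0 \<phi> \<psi> u] tensor_eval_scaleR_right[of \<phi> 0 \<psi> u] by auto
next
  case False
  have "tensor_eval \<phi> \<psi> u = norm \<phi> * (norm \<psi> * tensor_eval (sgn \<phi>) (sgn \<psi>) u)"
    using False
    by (simp add: sgn_div_norm tensor_eval_scaleR_left tensor_eval_scaleR_right field_simps)
  moreover have "\<bar>tensor_eval (sgn \<phi>) (sgn \<psi>) u\<bar> \<le> inj_norm u"
    using False by (intro tensor_eval_le_inj_norm) (auto simp: norm_sgn)
  ultimately show ?thesis
    by (simp add: abs_mult mult.assoc mult_left_mono)
qed

lemma tensor_eval_diff_le:
  assumes "norm \<phi>' \<le> 1" "norm \<psi> \<le> 1"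
  shows "tensor_eval \<phi> \<psi> u - tensor_eval \<phi>' \<psi>' u \<le> (norm (\<phi> - \<phi>') + norm (\<psi> - \<psi>')) * inj_norm u"
proof -
  have "tensor_eval \<phi> \<psi> u - tensor_eval \<phi>' \<psi>' u
      = tensor_eval (\<phi> - \<phi>') \<psi> u + tensor_eval \<phi>' (\<psi> - \<psi>') u"
    using tensor_eval_add_left[of "\<phi> - \<phi>'" \<phi>' \<psi> u] tensor_eval_add_right[of \<phi>' "\<psi> - \<psi>'" \<psi>' u]
    by simp
  also have "\<dots> \<le> norm (\<phi> - \<phi>') * norm \<psi> * inj_norm u + norm \<phi>' * norm (\<psi> - \<psi>') * inj_norm u"
    using tensor_eval_le[of "\<phi> - \<phi>'" \<psi> u] tensor_eval_le[of \<phi>' "\<psi> - \<psi>'" u] by simp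
  also have "\<dots> \<le> norm (\<phi> - \<phi>') * 1 * inj_norm u + 1 * norm (\<psi> - \<psi>') * inj_norm u"
    using assms by (intro add_mono mult_right_mono mult_left_mono) (auto simp: inj_norm_nonneg)
  finally show ?thesis by (simp add: distrib_right)
qed

lemma inj_norm_tensor: "inj_norm (tensor x y) = norm x * norm y"
proof (rule antisym)
  show "inj_norm (tensor x y) \<le> norm x * norm y"
  proof (rule inj_norm_le)
    fix \<phi> :: "'a \<Rightarrow>\<^sub>L real" and \<psi> :: "'b \<Rightarrow>\<^sub>L real"
    assume "norm \<phi> = 1" "norm \<psi> = 1"
    then show "\<bar>tensor_eval \<phi> \<psi> (tensor x y)\<bar> \<le> norm x * norm y"
      using norm_blinfun[of \<phi> x] norm_blinfun[of \<psi> y] by (simp add: abs_mult mult_mono)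
  qed simp
  show "norm x * norm y \<le> inj_norm (tensor x y)"
  proof (cases "x = 0 \<or> y = 0")
    case True
    then show ?thesis by (auto simp: inj_norm_nonneg)
  next
    case False
    then obtain \<phi> :: "'a \<Rightarrow>\<^sub>L real" and \<psi> :: "'b \<Rightarrow>\<^sub>L real"
      where "norm \<phi> = 1" "\<phi> x = norm x" "norm \<psi> = 1" "\<psi> y = norm y"
      using norming_functional by metis
    then show ?thesis
      using tensor_eval_le_inj_norm[of \<phi> \<psi> "tensor x y"] by simp
  qed
qed

lemma inj_norm_nearly_attained:
  assumes "0 \<le> c" "c < inj_norm u"
  obtains \<phi> \<psi> where "norm \<phi> = 1" "norm \<psi> = 1" "c < tensor_eval \<phi> \<psi> u"
proof -
  obtain \<phi> \<psi> where "norm \<phi> = 1" "norm \<psi> = 1" "c < \<bar>tensor_eval \<phi> \<psi> u\<bar>"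
    using inj_norm_le[of c u] assms by (meson not_le)
  then show thesis
    using that[of \<phi> \<psi>] that[of "- \<phi>" \<psi>]
    by (cases "tensor_eval \<phi> \<psi> u \<ge> 0") (auto simp: tensor_eval_minus_left)
qed

lemma tensor_minus_left: "tensor (- x) y = - tensor x y"
  using tensor_scaleR_left[of "-1" x y] by simp

lemma tensor_minus_right: "tensor x (- y) = - tensor x y"
  using tensor_scaleR_right[of x "-1" y] by simp


section \<open>Roughness passes from a factor to the tensor product\<close>

text \<open>
  Elementary tensors span a dense subspace of the completion, so contractions of
  algebraic tensors suffice.
\<close>

lemma rough_inj_tensorI:
  assumes rough: "rough_norm TYPE('x::real_normed_vector)"
    and sections: "\<And>(v :: ('a::real_normed_vector, 'b::real_normed_vector) tensor) c.
      0 \<le> c \<Longrightarrow> c < inj_norm v \<Longrightarrow> \<exists>(x :: 'x) J. c \<le> norm x \<and>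
        (\<forall>h. J (- h) = - J h \<and> inj_norm (J h) \<le> 2 * norm h \<and> norm (x + h) \<le> inj_norm (v + J h))"
  shows "rough_norm TYPE(('a, 'b) inj_tensor)"
  using rough
proof (rule rough_norm_transfer)
  fix z :: "('a, 'b) inj_tensor" and \<tau> :: real
  assume z: "norm z = 1" and \<tau>: "0 < \<tau>" "\<tau> < 1"
  obtain v where v: "norm (z - of_tensor v) < \<tau>"
    using of_tensor_dense[OF \<tau>(1)] by blast
  have "1 - \<tau> < inj_norm v"
    using v z norm_triangle_ineq2[of z "of_tensor v"] by (simp add: norm_of_tensor)
  then obtain x :: 'x and J where x: "1 - \<tau> \<le> norm x"
    and J: "\<And>h. J (- h) = - J h" "\<And>h. inj_norm (J h) \<le> 2 * norm h"
      "\<And>h. norm (x + h) \<le> inj_norm (v + J h)"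
    using sections[of "1 - \<tau>" v] \<tau> by auto
  have plus: "norm (x + h) \<le> norm (z + of_tensor (J h)) + \<tau>" for h
  proof -
    have "inj_norm (v + J h) = norm (z + of_tensor (J h) - (z - of_tensor v))"
      by (simp add: linear_add[OF linear_of_tensor] add.commute flip: norm_of_tensor)
    also have "\<dots> \<le> norm (z + of_tensor (J h)) + \<tau>"
      using v norm_triangle_ineq4[of "z + of_tensor (J h)" "z - of_tensor v"] by simp
    finally show ?thesis using J(3)[of h] by simp
  qed
  have minus: "norm (x - h) \<le> norm (z - of_tensor (J h)) + \<tau>" for h
    using plus[of "- h"] by (simp add: J(1) linear_neg[OF linear_of_tensor])
  show "\<exists>(x :: 'x) J. norm x \<ge> 1 - \<tau> \<and> (\<forall>h. norm (J h) \<le> 2 * norm h \<and>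
      norm (x + h) \<le> norm (z + J h) + \<tau> \<and> norm (x - h) \<le> norm (z - J h) + \<tau>)"
    using x J(2) plus minus
    by (intro exI[of _ x] exI[of _ "\<lambda>h. of_tensor (J h)"]) (auto simp: norm_of_tensor)
qed

text \<open>
  With \<open>\<psi> y = 1\<close>, contraction by \<open>\<psi>\<close> takes \<open>v + tensor h y\<close> to \<open>x + h\<close>.
\<close>

lemma rough_inj_tensor_left:
  assumes "rough_norm TYPE('a::real_normed_vector)"
  shows "rough_norm TYPE(('a, 'b::real_normed_vector) inj_tensor)"
  using assms
proof (rule rough_inj_tensorI)
  fix v :: "('a, 'b) tensor" and c :: real
  assume c: "0 \<le> c" "c < inj_norm v"
  then obtain \<phi> \<psi> where n: "norm \<phi> = 1" "norm \<psi> = 1" "c < tensor_eval \<phi> \<psi> v"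
    by (rule inj_norm_nearly_attained)
  obtain x where x: "\<And>\<phi>. blinfun_apply \<phi> x = tensor_eval \<phi> \<psi> v"
    using contraction_left by blast
  obtain y where y: "norm y \<le> 2" "\<psi> y = 1"
    using functional_attains_one[OF n(2)] by blast
  have "c \<le> norm x"
    using norm_blinfun[of \<phi> x] n by (simp add: x)
  moreover have "norm (x + h) \<le> inj_norm (v + tensor h y)" for h
  proof (rule norm_le_if_functionals_le)
    fix \<phi> :: "'a \<Rightarrow>\<^sub>L real"
    assume "norm \<phi> = 1"
    then show "\<phi> (x + h) \<le> inj_norm (v + tensor h y)"
      using tensor_eval_le_inj_norm[of \<phi> \<psi> "v + tensor h y"] n(2)
      by (simp add: blinfun.add_right x tensor_eval_add y(2))
  qed (rule inj_norm_nonneg)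
  ultimately show "\<exists>(x :: 'a) J. c \<le> norm x \<and>
      (\<forall>h. J (- h) = - J h \<and> inj_norm (J h) \<le> 2 * norm h \<and> norm (x + h) \<le> inj_norm (v + J h))"
    using y(1)
    by (intro exI[of _ x] exI[of _ "\<lambda>h. tensor h y"])
      (auto simp: tensor_minus_left inj_norm_tensor mult.commute[of _ "norm y"] mult_right_mono)
qed

lemma rough_inj_tensor_right:
  assumes "rough_norm TYPE('b::real_normed_vector)"
  shows "rough_norm TYPE(('a::real_normed_vector, 'b) inj_tensor)"
  using assms
proof (rule rough_inj_tensorI)
  fix v :: "('a, 'b) tensor" and c :: real
  assume c: "0 \<le> c" "c < inj_norm v"
  then obtain \<phi> \<psi> where n: "norm \<phi> = 1" "norm \<psi> = 1" "c < tensor_eval \<phi> \<psi> v"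
    by (rule inj_norm_nearly_attained)
  obtain y where y: "\<And>\<psi>. blinfun_apply \<psi> y = tensor_eval \<phi> \<psi> v"
    using contraction_right by blast
  obtain x where x: "norm x \<le> 2" "\<phi> x = 1"
    using functional_attains_one[OF n(1)] by blast
  have "c \<le> norm y"
    using norm_blinfun[of \<psi> y] n by (simp add: y)
  moreover have "norm (y + h) \<le> inj_norm (v + tensor x h)" for h
  proof (rule norm_le_if_functionals_le)
    fix \<psi> :: "'b \<Rightarrow>\<^sub>L real"
    assume "norm \<psi> = 1"
    then show "\<psi> (y + h) \<le> inj_norm (v + tensor x h)"
      using tensor_eval_le_inj_norm[of \<phi> \<psi> "v + tensor x h"] n(1)
      by (simp add: blinfun.add_right y tensor_eval_add x(2))
  qed (rule inj_norm_nonneg)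
  ultimately show "\<exists>(y :: 'b) J. c \<le> norm y \<and>
      (\<forall>h. J (- h) = - J h \<and> inj_norm (J h) \<le> 2 * norm h \<and> norm (y + h) \<le> inj_norm (v + J h))"
    using x(1)
    by (intro exI[of _ y] exI[of _ "\<lambda>h. tensor x h"])
      (auto simp: tensor_minus_right inj_norm_tensor mult_right_mono)
qed


section \<open>Roughness at an elementary tensor\<close>

text \<open>
  A pair that nearly norms a small perturbation of \<open>tensor x y\<close> has \<open>\<phi> x * \<psi> y\<close> close to one,
  so both factors have the same sign and modulus close to one. Changing the sign of both
  functionals changes no value at tensors and makes the factors positive.
\<close>

lemma nearly_norming_near_tensor:
  fixes x :: "'a::real_normed_vector" and y :: "'b::real_normed_vector"
  assumes xy: "norm x = 1" "norm y = 1"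
    and \<sigma>: "0 < \<sigma>" "2 * inj_norm w + \<sigma> \<le> \<delta>" "\<delta> \<le> 1"
  obtains \<phi> \<psi> where "norm \<phi> = 1" "norm \<psi> = 1"
    "blinfun_apply \<phi> x > 1 - \<delta>" "blinfun_apply \<psi> y > 1 - \<delta>"
    "tensor_eval \<phi> \<psi> (tensor x y + w) > inj_norm (tensor x y + w) - \<sigma>"
proof -
  let ?N = "inj_norm (tensor x y + w)"
  have N: "?N \<ge> 1 - inj_norm w"
    using inj_norm_triangle[of "tensor x y + w" "- w"] xy by (simp add: inj_norm_tensor)
  then have "0 \<le> ?N - \<sigma>" "?N - \<sigma> < ?N"
    using \<sigma> inj_norm_nonneg[of w] by auto
  then obtain \<phi> \<psi> where n: "norm \<phi> = 1" "norm \<psi> = 1"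
    and ev: "?N - \<sigma> < tensor_eval \<phi> \<psi> (tensor x y + w)"
    by (rule inj_norm_nearly_attained)
  have prod: "\<phi> x * \<psi> y > 1 - \<delta>"
    using ev tensor_eval_le_inj_norm[OF n, of w] N \<sigma>(2) by (simp add: tensor_eval_add)
  have le1: "\<bar>\<phi> x\<bar> \<le> 1" "\<bar>\<psi> y\<bar> \<le> 1"
    using norm_blinfun[of \<phi> x] norm_blinfun[of \<psi> y] n xy by auto
  have "\<bar>\<phi> x\<bar> * \<bar>\<psi> y\<bar> > 1 - \<delta>"
    using prod by (simp flip: abs_mult)
  moreover have "\<bar>\<phi> x\<bar> * \<bar>\<psi> y\<bar> \<le> \<bar>\<phi> x\<bar>" "\<bar>\<phi> x\<bar> * \<bar>\<psi> y\<bar> \<le> \<bar>\<psi> y\<bar>"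
    using le1 by (auto intro: mult_left_le mult_left_le_one_le)
  ultimately have big: "\<bar>\<phi> x\<bar> > 1 - \<delta>" "\<bar>\<psi> y\<bar> > 1 - \<delta>" by auto
  have "\<phi> x * \<psi> y > 0" using prod \<sigma>(3) by simp
  then consider "\<phi> x > 0" "\<psi> y > 0" | "\<phi> x < 0" "\<psi> y < 0"
    by (auto simp: zero_less_mult_iff)
  then show thesis
  proof cases
    case 1
    then show thesis using that[of \<phi> \<psi>] n big ev by auto
  next
    case 2
    then show thesis
      using that[of "- \<phi>" "- \<psi>"] n big ev
      by (auto simp: blinfun.minus_left tensor_eval_minus_left tensor_eval_minus_right)
  qed
qed

text \<open>
  If \<open>(\<phi>, \<psi>)\<close> nearly norms \<open>tensor x y + w\<close> and \<open>(\<phi>', \<psi>')\<close> nearly norms \<open>tensor x y - w\<close>, then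
  the sum of the two norms is, up to a small error, at most two plus the difference of the
  values of the pairs at \<open>w\<close>, and the pairs are within \<open>2 * a\<close> and \<open>2 * b\<close> of each other. Density extends the
  estimate from algebraic tensors \<open>w\<close> to all \<open>h\<close>.
\<close>

lemma roughness_at_tensor_le:
  fixes x :: "'a::real_normed_vector" and y :: "'b::real_normed_vector"
  assumes x: "norm x = 1" "roughness_at x < ereal a" "a > 0"
    and y: "norm y = 1" "roughness_at y < ereal b" "b > 0"
  shows "roughness_at (of_tensor (tensor x y)) \<le> ereal (2 * (a + b))"
proof -
  let ?T = "tensor x y" and ?e = "2 * (a + b)"
  obtain \<delta>1 where \<delta>1: "\<delta>1 > 0" "\<And>\<phi> \<phi>' :: 'a \<Rightarrow>\<^sub>L real. norm \<phi> \<le> 1 \<Longrightarrow> norm \<phi>' \<le> 1 \<Longrightarrow>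
      blinfun_apply \<phi> x > 1 - \<delta>1 \<Longrightarrow> blinfun_apply \<phi>' x > 1 - \<delta>1 \<Longrightarrow> norm (\<phi> - \<phi>') \<le> 2 * a"
    using functionals_close[OF x(1,3,2)] by metis
  obtain \<delta>2 where \<delta>2: "\<delta>2 > 0" "\<And>\<psi> \<psi>' :: 'b \<Rightarrow>\<^sub>L real. norm \<psi> \<le> 1 \<Longrightarrow> norm \<psi>' \<le> 1 \<Longrightarrow>
      blinfun_apply \<psi> y > 1 - \<delta>2 \<Longrightarrow> blinfun_apply \<psi>' y > 1 - \<delta>2 \<Longrightarrow> norm (\<psi> - \<psi>') \<le> 2 * b"
    using functionals_close[OF y(1,3,2)] by metis
  define \<delta> where "\<delta> = min 1 (min \<delta>1 \<delta>2)"
  have \<delta>: "\<delta> > 0" "\<delta> \<le> 1" "\<delta> \<le> \<delta>1" "\<delta> \<le> \<delta>2"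
    using \<delta>1(1) \<delta>2(1) by (auto simp: \<delta>_def)
  have algebraic: "inj_norm (?T + w) + inj_norm (?T - w) \<le> 2 + ?e * inj_norm w"
    if w: "inj_norm w \<le> \<delta> / 4" for w
  proof (rule field_le_epsilon)
    fix E :: real assume E: "E > 0"
    define \<sigma> where "\<sigma> = min (\<delta> / 2) (E / 2)"
    have \<sigma>: "0 < \<sigma>" "2 * inj_norm w + \<sigma> \<le> \<delta>" "2 * inj_norm (- w) + \<sigma> \<le> \<delta>" "2 * \<sigma> \<le> E"
      using E \<delta>(1) w by (auto simp: \<sigma>_def)
    obtain \<phi> \<psi> where 1: "norm \<phi> = 1" "norm \<psi> = 1"
      "blinfun_apply \<phi> x > 1 - \<delta>" "blinfun_apply \<psi> y > 1 - \<delta>"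
      "tensor_eval \<phi> \<psi> (?T + w) > inj_norm (?T + w) - \<sigma>"
      using nearly_norming_near_tensor[OF x(1) y(1) \<sigma>(1,2) \<delta>(2)] by blast
    obtain \<phi>' \<psi>' where 2: "norm \<phi>' = 1" "norm \<psi>' = 1"
      "blinfun_apply \<phi>' x > 1 - \<delta>" "blinfun_apply \<psi>' y > 1 - \<delta>"
      "tensor_eval \<phi>' \<psi>' (?T + - w) > inj_norm (?T + - w) - \<sigma>"
      using nearly_norming_near_tensor[OF x(1) y(1) \<sigma>(1,3) \<delta>(2)] by blast
    have "norm (\<phi> - \<phi>') \<le> 2 * a" "norm (\<psi> - \<psi>') \<le> 2 * b"
      using 1 2 \<delta> by (auto intro!: \<delta>1(2) \<delta>2(2))
    then have "(norm (\<phi> - \<phi>') + norm (\<psi> - \<psi>')) * inj_norm w \<le> ?e * inj_norm w"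
      by (intro mult_right_mono) (auto simp: inj_norm_nonneg)
    then have diff: "tensor_eval \<phi> \<psi> w - tensor_eval \<phi>' \<psi>' w \<le> ?e * inj_norm w"
      using tensor_eval_diff_le[of \<phi>' \<psi> \<phi> w \<psi>'] 1 2 by simp
    have "tensor_eval \<phi> \<psi> ?T \<le> 1" "tensor_eval \<phi>' \<psi>' ?T \<le> 1"
      using tensor_eval_le_inj_norm[of \<phi> \<psi> ?T] tensor_eval_le_inj_norm[of \<phi>' \<psi>' ?T] 1 2 x y
      by (auto simp: inj_norm_tensor)
    moreover have "tensor_eval \<phi>' \<psi>' (?T + - w) = tensor_eval \<phi>' \<psi>' ?T - tensor_eval \<phi>' \<psi>' w"
      using linear_diff[OF linear_tensor_eval, of \<phi>' \<psi>' ?T w] by simp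
    ultimately show "inj_norm (?T + w) + inj_norm (?T - w) \<le> 2 + ?e * inj_norm w + E"
      using 1(5) 2(5) diff \<sigma>(4) by (simp add: tensor_eval_add)
  qed
  \<comment> \<open>Approximants \<open>w\<close> of a tensor of norm \<open>r\<close> then still satisfy \<open>inj_norm w \<le> \<delta> / 4\<close>.\<close>
  define r where "r = \<delta> / 8"
  have r: "r > 0" using \<delta> by (simp add: r_def)
  show ?thesis
  proof (rule roughness_at_leI[OF _ r])
    show "norm (of_tensor ?T) = 1"
      using x y by (simp add: norm_of_tensor inj_norm_tensor)
    fix h :: "('a, 'b) inj_tensor" assume h: "norm h = r"
    show "norm (of_tensor ?T + h) + norm (of_tensor ?T - h) \<le> 2 + ?e * r"
    proof (rule field_le_epsilon)
      fix E :: real assume E: "E > 0"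
      define \<eta> where "\<eta> = min r (E / (?e + 2))"
      have pos: "?e + 2 > 0" using x(3) y(3) by simp
      have \<eta>: "0 < \<eta>" "\<eta> \<le> r" using E r pos by (auto simp: \<eta>_def)
      have "\<eta> \<le> E / (?e + 2)" by (simp add: \<eta>_def)
      then have small: "\<eta> * (?e + 2) \<le> E"
        by (simp only: pos_le_divide_eq[OF pos])
      obtain w where w: "norm (h - of_tensor w) < \<eta>"
        using of_tensor_dense[OF \<eta>(1)] by blast
      have nw: "inj_norm w \<le> r + \<eta>"
        using w h norm_triangle_ineq2[of "of_tensor w" h]
        by (simp add: norm_of_tensor norm_minus_commute)
      have "norm (of_tensor ?T + h) \<le> inj_norm (?T + w) + \<eta>"
        using w norm_triangle_ineq[of "of_tensor (?T + w)" "h - of_tensor w"]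
        by (simp add: linear_add[OF linear_of_tensor] flip: norm_of_tensor)
      moreover have "norm (of_tensor ?T - h) \<le> inj_norm (?T - w) + \<eta>"
        using w norm_triangle_ineq4[of "of_tensor (?T - w)" "h - of_tensor w"]
        by (simp add: linear_diff[OF linear_of_tensor] flip: norm_of_tensor)
      moreover have "inj_norm (?T + w) + inj_norm (?T - w) \<le> 2 + ?e * inj_norm w"
        using nw \<eta>(2) by (intro algebraic) (simp add: r_def)
      moreover have "?e * inj_norm w \<le> ?e * (r + \<eta>)"
        using nw x(3) y(3) by (intro mult_left_mono) auto
      ultimately show "norm (of_tensor ?T + h) + norm (of_tensor ?T - h) \<le> 2 + ?e * r + E"
        using small by (simp add: algebra_simps)
    qed
  qed
qed


section \<open>Non-roughness of the injective tensor product\<close>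

lemma non_rough_norm_iff:
  "non_rough_norm TYPE('a::real_normed_vector) \<longleftrightarrow>
    (\<forall>\<epsilon>>0. \<exists>u::'a. norm u = 1 \<and> roughness_at u < ereal \<epsilon>)"
  unfolding rough_norm_def eps_rough_norm_def by (auto simp: not_le Bex_def)

theorem proposition3p4:
  shows "non_rough_norm TYPE(('x::banach, 'y::banach) inj_tensor) \<longleftrightarrow>
    non_rough_norm TYPE('x) \<and> non_rough_norm TYPE('y)"
proof
  assume "non_rough_norm TYPE(('x, 'y) inj_tensor)"
  then show "non_rough_norm TYPE('x) \<and> non_rough_norm TYPE('y)"
    using rough_inj_tensor_left rough_inj_tensor_right by blast
next
  assume nr: "non_rough_norm TYPE('x) \<and> non_rough_norm TYPE('y)"
  have "\<exists>z :: ('x, 'y) inj_tensor. norm z = 1 \<and> roughness_at z < ereal e" if e: "e > 0" for e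
  proof -
    have "e / 6 > 0" using e by simp
    then obtain x :: 'x and y :: 'y where xy: "norm x = 1" "roughness_at x < ereal (e / 6)"
      "norm y = 1" "roughness_at y < ereal (e / 6)"
      using nr unfolding non_rough_norm_iff by meson
    then have "roughness_at (of_tensor (tensor x y)) \<le> ereal (2 * (e / 6 + e / 6))"
      using e by (intro roughness_at_tensor_le) auto
    also have "\<dots> < ereal e" using e by simp
    finally show ?thesis
      using xy by (intro exI[of _ "of_tensor (tensor x y)"]) (auto simp: norm_of_tensor inj_norm_tensor)
  qed
  then show "non_rough_norm TYPE(('x, 'y) inj_tensor)"
    unfolding non_rough_norm_iff by blast
qed

end
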